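(* Let $\mathcal{C}\subseteq\mathbb{Z}_2^\alpha\times R^\beta$ be a $\mathbb{Z}_2R$ linear self-dual code of length $\ell=\alpha+\beta$ and type $(\alpha,\beta;\gamma,\delta;\kappa)$, with generator matrix whose rows are $(\mathbf g_i|\mathbf r_i)$, $\mathbf g_i\in\mathbb{Z}_2^\alpha$, $\mathbf r_i\in R^\beta$, $1\le i\le\gamma+\delta$. Let $\mathbf x\in\mathbb{Z}_2^\alpha$ with $wt_H(\mathbf x)$ odd and let $\mathbf y\in u\mathbb{Z}_2^\beta=\{0,u\}^\beta$ with $\langle\mathbf r_i,\mathbf y\rangle=0$ for $1\le i\le\gamma+\delta$. Put $h_i=\langle\mathbf g_i,\mathbf x\rangle$ for $1\le i\le\gamma+\delta$. Then the matrix $$G=\left(\begin{array}{ccc|c}1&0&\mathbf x&\mathbf y\\ \hline h_1&h_1&\mathbf g_1&\mathbf r_1\\ \vdots&\vdots&\vdots&\vdots\\ h_{\gamma+\delta}&h_{\gamma+\delta}&\mathbf g_{\gamma+\delta}&\mathbf r_{\gamma+\delta}\end{array}\right)$$ generates a self-dual code $\mathcal{D}\subseteq\mathbb{Z}_2^{\alpha+2}\times R^\beta$ over $\mathbb{Z}_2R$ of length $\ell+2$. Moreover, $\mathcal{C}$ is separable if and only if $\mathcal{D}$ is separable.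
   Context: Let $R=\mathbb{Z}_2+u\mathbb{Z}_2=\{0,1,u,1+u\}$ with $u^2=0$, and $\eta:R\to\mathbb{Z}_2$, $\eta(r+uq)=r$. The set $\mathbb{Z}_2^\alpha\times R^\beta$ is an $R$-module under $d(a_1,\dots,a_\alpha\mid b_1,\dots,b_\beta)=(\eta(d)a_1,\dots,\eta(d)a_\alpha\mid db_1,\dots,db_\beta)$. A $\mathbb{Z}_2R$ linear code is an $R$-submodule $\mathcal{C}$ of $\mathbb{Z}_2^\alpha\times R^\beta$; a generator matrix is one whose rows generate the code as an $R$-module. Type $(\alpha,\beta;\gamma,\delta;\kappa)$ means $\mathcal{C}\cong(R/uR)^\gamma\oplus R^\delta$ as an $R$-module, and $\kappa=\dim_{\mathbb{Z}_2}$ of the projection to the first $\alpha$ coordinates of the subcode of codewords whose last $\beta$ coordinates lie in $\{0,u\}$. The inner product is $\langle(\mathbf v|\mathbf w),(\mathbf x|\mathbf y)\rangle=u\sum_{i=1}^\alpha v_ix_i+\sum_{j=1}^\beta w_jy_j\in R$; $\mathcal{C}^\perp$ is the set of vectors orthogonal to all of $\mathcal{C}$; $\mathcal{C}$ is self-dual if $\mathcal{C}=\mathcal{C}^\perp$. For two vectors in $\mathbb{Z}_2^\alpha$, or two vectors in $R^\beta$, $\langle\cdot,\cdot\rangle$ is the usual dot product with values in $\mathbb{Z}_2$, respectively $R$. $wt_H$ is the Hamming weight. With $\mathcal{C}_X$, $\mathcal{C}_Y$ the projections of a code $\mathcal{C}$ to its $\mathbb{Z}_2$-coordinates and its $R$-coordinates,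 $\mathcal{C}$ is separable if $\mathcal{C}=\mathcal{C}_X\times\mathcal{C}_Y$. *)

theory Defs
  imports "HOL-Library.Z2" "Jordan_Normal_Form.VS_Connect" "HOL-Algebra.QuotRing"
begin

section \<open>The ring \<open>R = Z\<^sub>2 + u Z\<^sub>2\<close> with \<open>u\<^sup>2 = 0\<close>\<close>

text \<open>\<open>Z2u r q\<close> stands for \<open>r + u q\<close>, so that the selector \<^term>\<open>eta\<close> is the map
  \<open>\<eta> : R \<rightarrow> Z\<^sub>2\<close>.\<close>

datatype z2u = Z2u (eta: bit) (ucoeff: bit)

instantiation z2u :: comm_ring_1
begin

definition zero_z2u :: z2u where "0 = Z2u 0 0"
definition one_z2u :: z2u where "1 = Z2u 1 0"
definition plus_z2u :: "z2u \<Rightarrow> z2u \<Rightarrow> z2u"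
  where "a + b = Z2u (eta a + eta b) (ucoeff a + ucoeff b)"
definition uminus_z2u :: "z2u \<Rightarrow> z2u" where "- a = Z2u (- eta a) (- ucoeff a)"
definition minus_z2u :: "z2u \<Rightarrow> z2u \<Rightarrow> z2u"
  where "a - b = Z2u (eta a - eta b) (ucoeff a - ucoeff b)"
definition times_z2u :: "z2u \<Rightarrow> z2u \<Rightarrow> z2u"
  where "a * b = Z2u (eta a * eta b) (eta a * ucoeff b + ucoeff a * eta b)"

instance
proof
  fix a b c :: z2u
  show "a + b + c = a + (b + c)" "a + b = b + a" "a * b * c = a * (b * c)" "a * b = b * a"
      "(a + b) * c = a * c + b * c"
    by (simp_all only: plus_z2u_def times_z2u_def z2u.sel distrib_left distrib_right add_ac mult_ac)
  show "0 + a = a" "1 * a = a" "- a + a = 0" "a - b = a + - b" "(0::z2u) \<noteq> 1"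
    by (simp_all only: zero_z2u_def one_z2u_def plus_z2u_def times_z2u_def uminus_z2u_def
        minus_z2u_def z2u.sel z2u.inject z2u.collapse add_0 mult_1 mult_zero_left add_0_right
        ab_left_minus diff_conv_add_uminus zero_neq_one) simp_all
qed

end

lemma eta_add: "eta (a + b) = eta a + eta b"
  and eta_mult: "eta (a * b) = eta a * eta b"
  and eta_one: "eta 1 = 1"
  by (simp_all add: plus_z2u_def times_z2u_def one_z2u_def)

definition u_elt :: z2u where "u_elt = Z2u 0 1"

text \<open>The inclusion \<open>Z\<^sub>2 \<subseteq> R\<close>.\<close>

definition of_z2 :: "bit \<Rightarrow> z2u" where "of_z2 a = Z2u a 0"

lemma u_elt_squared: "u_elt * u_elt = 0"
  by (simp add: u_elt_def times_z2u_def zero_z2u_def)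

lemma Z2u_eq: "Z2u r q = of_z2 r + u_elt * of_z2 q"
  by (simp add: of_z2_def u_elt_def times_z2u_def plus_z2u_def)


section \<open>The \<open>R\<close>-module \<open>Z\<^sub>2\<^sup>\<alpha> \<times> R\<^sup>\<beta>\<close> and its submodules\<close>

type_synonym z2r = "bit vec \<times> z2u vec"

text \<open>The fields \<open>mult\<close> and \<open>one\<close> of a module record play no role.\<close>

definition z2r_module :: "nat \<Rightarrow> nat \<Rightarrow> (z2u, z2r) module" where
  "z2r_module \<alpha> \<beta> = \<lparr>
     carrier = carrier_vec \<alpha> \<times> carrier_vec \<beta>,
     mult = undefined,
     one = undefined,
     zero = (0\<^sub>v \<alpha>, 0\<^sub>v \<beta>),
     add = (\<lambda>(a, b) (a', b'). (a + a', b + b')),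
     smult = (\<lambda>d (a, b). (eta d \<cdot>\<^sub>v a, d \<cdot>\<^sub>v b)) \<rparr>"

lemma z2r_module_is_module: "Module.module class_ring (z2r_module \<alpha> \<beta>)"
proof (rule Module.moduleI)
  show "cring (class_ring :: z2u ring)"
    by unfold_locales (auto simp: algebra_simps Units_def intro: exI[of _ "- x" for x])
  show "abelian_group (z2r_module \<alpha> \<beta>)"
  proof (rule abelian_groupI)
    fix x assume "x \<in> carrier (z2r_module \<alpha> \<beta>)"
    then show "\<exists>y\<in>carrier (z2r_module \<alpha> \<beta>).
        y \<oplus>\<^bsub>z2r_module \<alpha> \<beta>\<^esub> x = \<zero>\<^bsub>z2r_module \<alpha> \<beta>\<^esub>"
      by (intro bexI[of _ "(- fst x, - snd x)"]) (auto simp: z2r_module_def uminus_l_inv_vec)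
  qed (auto simp: z2r_module_def assoc_add_vec comm_add_vec)
qed (auto simp: z2r_module_def smult_add_distrib_vec add_smult_distrib_vec smult_smult_assoc
    eta_add eta_mult eta_one)

definition z2r_linear_code :: "nat \<Rightarrow> nat \<Rightarrow> z2r set \<Rightarrow> bool" where
  "z2r_linear_code \<alpha> \<beta> C \<longleftrightarrow> LinearCombinations.submodule class_ring C (z2r_module \<alpha> \<beta>)"

definition z2r_span :: "nat \<Rightarrow> nat \<Rightarrow> z2r set \<Rightarrow> z2r set" where
  "z2r_span \<alpha> \<beta> S = LinearCombinations.module.span class_ring (z2r_module \<alpha> \<beta>) S"

text \<open>A matrix is given as the list of its rows; linear independence of
  the rows is not part of the definition.\<close>

definition generator_matrix :: "nat \<Rightarrow> nat \<Rightarrow> z2r list \<Rightarrow> z2r set \<Rightarrow> bool" where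
  "generator_matrix \<alpha> \<beta> G C \<longleftrightarrow>
     set G \<subseteq> carrier (z2r_module \<alpha> \<beta>) \<and> C = z2r_span \<alpha> \<beta> (set G)"


section \<open>The type of a code\<close>

text \<open>A ring \<open>S\<close> as a module over \<open>R\<close> along a ring homomorphism \<open>f : R \<rightarrow> S\<close>.\<close>

definition ring_as_module :: "('b, 'd) ring_scheme \<Rightarrow> ('a \<Rightarrow> 'b) \<Rightarrow> ('a, 'b) module" where
  "ring_as_module S f = \<lparr>
     carrier = carrier S, mult = mult S, one = one S, zero = zero S, add = add S,
     smult = (\<lambda>r s. f r \<otimes>\<^bsub>S\<^esub> s) \<rparr>"

definition module_power :: "('a, 'b) module \<Rightarrow> nat \<Rightarrow> ('a, nat \<Rightarrow> 'b) module" where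
  "module_power M n = \<lparr>
     carrier = {..<n} \<rightarrow>\<^sub>E carrier M,
     mult = undefined,
     one = undefined,
     zero = (\<lambda>i\<in>{..<n}. \<zero>\<^bsub>M\<^esub>),
     add = (\<lambda>v w. \<lambda>i\<in>{..<n}. v i \<oplus>\<^bsub>M\<^esub> w i),
     smult = (\<lambda>r v. \<lambda>i\<in>{..<n}. r \<odot>\<^bsub>M\<^esub> v i) \<rparr>"

definition uR :: "z2u set" where "uR = PIdl\<^bsub>class_ring\<^esub> u_elt"

definition R_mod_uR :: "(z2u, z2u set) module" where
  "R_mod_uR = ring_as_module (class_ring Quot uR) (\<lambda>r. uR +>\<^bsub>class_ring\<^esub> r)"

definition R_regular :: "(z2u, z2u) module" where
  "R_regular = ring_as_module class_ring (\<lambda>r. r)"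

definition module_isomorphic ::
    "('a, 'c0) ring_scheme \<Rightarrow> ('a, 'b1, 'c1) module_scheme \<Rightarrow> ('a, 'b2, 'c2) module_scheme \<Rightarrow> bool"
  where "module_isomorphic K M N \<longleftrightarrow>
    (\<exists>f \<in> LinearCombinations.module_hom K M N. bij_betw f (carrier M) (carrier N))"

definition z2r_type ::
    "nat \<Rightarrow> nat \<Rightarrow> nat \<Rightarrow> nat \<Rightarrow> nat \<Rightarrow> z2r set \<Rightarrow> bool" where
  "z2r_type \<alpha> \<beta> \<gamma> \<delta> \<kappa> C \<longleftrightarrow>
     module_isomorphic class_ring ((z2r_module \<alpha> \<beta>)\<lparr>carrier := C\<rparr>)
       (direct_sum (module_power R_mod_uR \<gamma>) (module_power R_regular \<delta>)) \<and>
     \<kappa> = vectorspace.dim class_ring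
       ((module_vec TYPE(bit) \<alpha>)\<lparr>carrier := fst ` {c \<in> C. \<forall>j<\<beta>. snd c $ j \<in> {0, u_elt}}\<rparr>)"


section \<open>Duality, weight, separability\<close>

definition z2r_inner :: "z2r \<Rightarrow> z2r \<Rightarrow> z2u" where
  "z2r_inner c d = u_elt * of_z2 (fst c \<bullet> fst d) + snd c \<bullet> snd d"

definition z2r_dual :: "nat \<Rightarrow> nat \<Rightarrow> z2r set \<Rightarrow> z2r set" where
  "z2r_dual \<alpha> \<beta> C = {c \<in> carrier (z2r_module \<alpha> \<beta>). \<forall>d\<in>C. z2r_inner c d = 0}"

definition self_dual :: "nat \<Rightarrow> nat \<Rightarrow> z2r set \<Rightarrow> bool" where
  "self_dual \<alpha> \<beta> C \<longleftrightarrow> C = z2r_dual \<alpha> \<beta> C"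

definition hamming_weight :: "'a::zero vec \<Rightarrow> nat" where
  "hamming_weight v = card {i. i < dim_vec v \<and> v $ i \<noteq> 0}"

definition separable :: "z2r set \<Rightarrow> bool" where
  "separable C \<longleftrightarrow> C = fst ` C \<times> snd ` C"

end

theory Submission
  imports Defs
begin

text \<open>The code \<open>D\<close> has the intrinsic description
  \<open>D = {(z \<cdot> x, b, z | w). (z + (z \<cdot> x + b) x | w) \<in> C}\<close>. A vector \<open>(a, b, z | w)\<close> is orthogonal to
  all rows \<open>(h\<^sub>i, h\<^sub>i, g\<^sub>i | r\<^sub>i)\<close> iff \<open>(z + (a + b) x | w)\<close> is orthogonal to \<open>C\<close>, hence lies in \<open>C\<close>;
  as \<open>(0 | y) \<in> C\<^sup>\<bottom> = C\<close>, it is then orthogonal to the first row iff \<open>a = z \<cdot> x\<close>. So the set above is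
  the dual of \<open>D\<close>, it contains the rows of \<open>G\<close>, and \<open>x \<cdot> x = 1\<close> makes each of its elements a
  combination of the rows. Setting \<open>w\<close> to \<open>0\<close> commutes with this description, which gives the claim
  on separability.\<close>

section \<open>Arithmetic in characteristic two and vectors with a split-off first entry\<close>

lemma bit_add_self [simp]: "(a::bit) + a = 0"
  by (cases a) simp_all

lemma z2u_add_self [simp]: "(a::z2u) + a = 0"
  by (simp add: plus_z2u_def zero_z2u_def)

lemma vec_bit_add_self: "(v :: bit vec) + v = 0\<^sub>v (dim_vec v)"
  by (intro eq_vecI) simp_all

lemma vec_z2u_add_self: "(v :: z2u vec) + v = 0\<^sub>v (dim_vec v)"
  by (intro eq_vecI) simp_all

lemma zero_smult_bit_vec [simp]: "(0 :: bit) \<cdot>\<^sub>v v = 0\<^sub>v (dim_vec v)"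
  by (intro eq_vecI) simp_all

lemma vCons_add: "vCons a v + vCons b w = vCons (a + b) (v + w)"
  by (intro eq_vecI) (auto simp: vec_index_vCons)

lemma smult_vCons: "c \<cdot>\<^sub>v vCons a v = vCons (c * a) (c \<cdot>\<^sub>v v)"
  by (intro eq_vecI) (auto simp: vec_index_vCons)

lemma add_smult_add_vec:
  fixes x z z' :: "'a::comm_ring_1 vec"
  assumes "x \<in> carrier_vec n" "z \<in> carrier_vec n" "z' \<in> carrier_vec n"
  shows "z + s \<cdot>\<^sub>v x + (z' + s' \<cdot>\<^sub>v x) = z + z' + (s + s') \<cdot>\<^sub>v x"
  using assms by (intro eq_vecI) (auto simp: algebra_simps)

lemma smult_add_smult_vec:
  fixes x z :: "'a::comm_ring_1 vec"
  assumes "x \<in> carrier_vec n" "z \<in> carrier_vec n"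
  shows "k \<cdot>\<^sub>v (z + s \<cdot>\<^sub>v x) = k \<cdot>\<^sub>v z + (k * s) \<cdot>\<^sub>v x"
  using assms by (intro eq_vecI) (auto simp: algebra_simps)

lemma carrier_vec_Suc_cases:
  assumes "v \<in> carrier_vec (Suc n)"
  obtains a w where "v = vCons a w" "w \<in> carrier_vec n"
  using assms by (cases v) auto

lemma of_nat_bit: "(of_nat n :: bit) = of_bool (odd n)"
  by (induction n) simp_all

text \<open>Every bit is idempotent, so the product counts the nonzero entries modulo 2. This turns
  the odd weight of \<open>x\<close> into \<open>x \<bullet> x = 1\<close>.\<close>

lemma scalar_prod_self_bit: "(v :: bit vec) \<bullet> v = of_bool (odd (hamming_weight v))"
proof -
  have "v \<bullet> v = (\<Sum>i<dim_vec v. of_bool (v $ i \<noteq> 0))"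
    unfolding scalar_prod_def atLeast0LessThan by (intro sum.cong) auto
  also have "\<dots> = of_nat (hamming_weight v)"
    by (simp add: hamming_weight_def sum.If_cases of_bool_def Int_def lessThan_def)
  finally show ?thesis by (simp add: of_nat_bit)
qed

section \<open>Linear codes, spans, duals and separability\<close>

lemma carrier_z2r [simp]: "carrier (z2r_module \<alpha> \<beta>) = carrier_vec \<alpha> \<times> carrier_vec \<beta>"
  by (simp add: z2r_module_def)

lemma z2r_linear_code_iff:
  "z2r_linear_code \<alpha> \<beta> C \<longleftrightarrow>
     C \<subseteq> carrier_vec \<alpha> \<times> carrier_vec \<beta> \<and> (0\<^sub>v \<alpha>, 0\<^sub>v \<beta>) \<in> C \<and>
     (\<forall>a b a' b'. (a, b) \<in> C \<longrightarrow> (a', b') \<in> C \<longrightarrow> (a + a', b + b') \<in> C) \<and>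
     (\<forall>k a b. (a, b) \<in> C \<longrightarrow> (eta k \<cdot>\<^sub>v a, k \<cdot>\<^sub>v b) \<in> C)"
  unfolding z2r_linear_code_def LinearCombinations.submodule_def
  using z2r_module_is_module[of \<alpha> \<beta>] by (auto simp: z2r_module_def)

lemma z2r_span_linear_code:
  "S \<subseteq> carrier_vec \<alpha> \<times> carrier_vec \<beta> \<Longrightarrow> z2r_linear_code \<alpha> \<beta> (z2r_span \<alpha> \<beta> S)"
  unfolding z2r_linear_code_def z2r_span_def
  by (intro LinearCombinations.module.span_is_submodule z2r_module_is_module) simp

lemma z2r_span_superset:
  "S \<subseteq> carrier_vec \<alpha> \<times> carrier_vec \<beta> \<Longrightarrow> S \<subseteq> z2r_span \<alpha> \<beta> S"
  unfolding z2r_span_def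
  by (intro LinearCombinations.module.in_own_span z2r_module_is_module) simp

lemma z2r_span_least:
  "S \<subseteq> N \<Longrightarrow> z2r_linear_code \<alpha> \<beta> N \<Longrightarrow> z2r_span \<alpha> \<beta> S \<subseteq> N"
  unfolding z2r_linear_code_def z2r_span_def
  by (intro LinearCombinations.module.span_is_subset z2r_module_is_module)

text \<open>The third equation holds since \<open>u_elt\<close> annihilates the
  \<open>u\<close>-part of \<open>k\<close>. It makes the inner product homogeneous over
  \<open>R\<close>, although scalars act on the binary part only through \<open>eta\<close>.\<close>

lemma of_z2_simps:
  "of_z2 0 = 0" "of_z2 (a + b) = of_z2 a + of_z2 b" "u_elt * of_z2 (eta k * a) = k * (u_elt * of_z2 a)"
  by (simp_all add: of_z2_def zero_z2u_def plus_z2u_def times_z2u_def u_elt_def)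

lemma u_elt_of_z2_eq_0_iff [simp]: "u_elt * of_z2 a = 0 \<longleftrightarrow> a = 0"
  by (simp add: of_z2_def zero_z2u_def times_z2u_def u_elt_def)

text \<open>The inner product is \<open>R\<close>-linear in its first argument. \<open>S\<close>
  need not be a code, so the lemma also covers the dual of a single vector.\<close>

lemma z2r_dual_linear_code:
  assumes "S \<subseteq> carrier_vec \<alpha> \<times> carrier_vec \<beta>"
  shows "z2r_linear_code \<alpha> \<beta> (z2r_dual \<alpha> \<beta> S)"
  unfolding z2r_linear_code_iff
proof (intro conjI allI impI)
  show "z2r_dual \<alpha> \<beta> S \<subseteq> carrier_vec \<alpha> \<times> carrier_vec \<beta>"
    by (auto simp: z2r_dual_def)
  show "(0\<^sub>v \<alpha>, 0\<^sub>v \<beta>) \<in> z2r_dual \<alpha> \<beta> S"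
    using assms by (auto simp: z2r_dual_def z2r_inner_def of_z2_simps)
next
  fix a b a' b'
  assume *: "(a, b) \<in> z2r_dual \<alpha> \<beta> S" "(a', b') \<in> z2r_dual \<alpha> \<beta> S"
  have "z2r_inner (a + a', b + b') d = z2r_inner (a, b) d + z2r_inner (a', b') d"
    if "d \<in> S" for d
  proof -
    have "fst d \<in> carrier_vec \<alpha>" "snd d \<in> carrier_vec \<beta>" using that assms by auto
    then show ?thesis
      using * by (auto simp: z2r_dual_def z2r_inner_def of_z2_simps
          add_scalar_prod_distrib[of _ \<alpha>] add_scalar_prod_distrib[of _ \<beta>] algebra_simps)
  qed
  then show "(a + a', b + b') \<in> z2r_dual \<alpha> \<beta> S"
    using * by (auto simp: z2r_dual_def)
next
  fix k a b
  assume *: "(a, b) \<in> z2r_dual \<alpha> \<beta> S"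
  have "z2r_inner (eta k \<cdot>\<^sub>v a, k \<cdot>\<^sub>v b) d = k * z2r_inner (a, b) d" if "d \<in> S" for d
  proof -
    have "fst d \<in> carrier_vec \<alpha>" "snd d \<in> carrier_vec \<beta>" using that assms by auto
    then show ?thesis
      using * by (simp add: z2r_dual_def z2r_inner_def distrib_left flip: of_z2_simps(3))
  qed
  then show "(eta k \<cdot>\<^sub>v a, k \<cdot>\<^sub>v b) \<in> z2r_dual \<alpha> \<beta> S"
    using * by (auto simp: z2r_dual_def)
qed

lemma z2r_inner_commute:
  assumes "c \<in> carrier_vec \<alpha> \<times> carrier_vec \<beta>" "d \<in> carrier_vec \<alpha> \<times> carrier_vec \<beta>"
  shows "z2r_inner c d = z2r_inner d c"
  using assms by (auto simp: z2r_inner_def comm_scalar_prod[of _ \<alpha>] comm_scalar_prod[of _ \<beta>])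

text \<open>If \<open>c\<close> is orthogonal to \<open>S\<close>, then \<open>S\<close> lies in the
  dual of \<open>{c}\<close>. That dual is a code, so it contains the whole span, and no linear
  combination has to be expanded.\<close>

lemma z2r_dual_span:
  assumes S: "S \<subseteq> carrier_vec \<alpha> \<times> carrier_vec \<beta>"
  shows "z2r_dual \<alpha> \<beta> (z2r_span \<alpha> \<beta> S) = z2r_dual \<alpha> \<beta> S"
proof
  show "z2r_dual \<alpha> \<beta> (z2r_span \<alpha> \<beta> S) \<subseteq> z2r_dual \<alpha> \<beta> S"
    using z2r_span_superset[OF S] by (auto simp: z2r_dual_def)
  show "z2r_dual \<alpha> \<beta> S \<subseteq> z2r_dual \<alpha> \<beta> (z2r_span \<alpha> \<beta> S)"
  proof
    fix c assume c: "c \<in> z2r_dual \<alpha> \<beta> S"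
    then have cc: "c \<in> carrier_vec \<alpha> \<times> carrier_vec \<beta>" by (simp add: z2r_dual_def)
    have "S \<subseteq> z2r_dual \<alpha> \<beta> {c}"
    proof
      fix d assume "d \<in> S"
      then show "d \<in> z2r_dual \<alpha> \<beta> {c}"
        using c S z2r_inner_commute[OF cc, of d] by (auto simp: z2r_dual_def)
    qed
    then have "z2r_span \<alpha> \<beta> S \<subseteq> z2r_dual \<alpha> \<beta> {c}"
      using cc by (intro z2r_span_least z2r_dual_linear_code) auto
    then show "c \<in> z2r_dual \<alpha> \<beta> (z2r_span \<alpha> \<beta> S)"
      using cc z2r_inner_commute[OF cc] by (fastforce simp: z2r_dual_def)
  qed
qed

text \<open>The mixed pair \<open>(a, b')\<close> is the sum of \<open>(a, 0)\<close> and
  \<open>(0, b')\<close>, and \<open>(0, b')\<close> is the sum of \<open>(a', b')\<close> and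
  \<open>(a', 0)\<close> in characteristic two. So only erasing the \<open>R\<close>-part has to be
  checked.\<close>

lemma separable_linear_code_iff:
  assumes "z2r_linear_code \<alpha> \<beta> C"
  shows "separable C \<longleftrightarrow> (\<forall>a b. (a, b) \<in> C \<longrightarrow> (a, 0\<^sub>v \<beta>) \<in> C)"
proof
  have sub: "C \<subseteq> carrier_vec \<alpha> \<times> carrier_vec \<beta>" and zero: "(0\<^sub>v \<alpha>, 0\<^sub>v \<beta>) \<in> C"
    and add: "\<And>a b a' b'. (a, b) \<in> C \<Longrightarrow> (a', b') \<in> C \<Longrightarrow> (a + a', b + b') \<in> C"
    using assms by (auto simp: z2r_linear_code_iff)
  show "\<forall>a b. (a, b) \<in> C \<longrightarrow> (a, 0\<^sub>v \<beta>) \<in> C" if "separable C"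
    using that zero unfolding separable_def by (metis fst_conv snd_conv image_eqI mem_Times_iff)
  assume *: "\<forall>a b. (a, b) \<in> C \<longrightarrow> (a, 0\<^sub>v \<beta>) \<in> C"
  have "(a, b') \<in> C" if "(a, b) \<in> C" "(a', b') \<in> C" for a b a' b'
  proof -
    have car: "a \<in> carrier_vec \<alpha>" "a' \<in> carrier_vec \<alpha>" "b' \<in> carrier_vec \<beta>"
      using that sub by auto
    have "(a' + a', b' + 0\<^sub>v \<beta>) \<in> C" using add * that(2) by blast
    then have "(0\<^sub>v \<alpha>, b') \<in> C" using car by (simp add: vec_bit_add_self)
    then have "(a + 0\<^sub>v \<alpha>, 0\<^sub>v \<beta> + b') \<in> C" using add * that(1) by blast
    then show ?thesis using car by simp
  qed
  then show "separable C" by (force simp: separable_def)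
qed

section \<open>The extended code without reference to generators\<close>

text \<open>The correction by \<open>x\<close> vanishes exactly when the two leading bits agree;
  those words form a copy of \<open>C\<close>. The vector \<open>y\<close> does not appear: where
  the definition is applied, \<open>(0 | y)\<close> lies in \<open>C\<close>, so a shift by it is
  absorbed.\<close>

definition double_extension :: "nat \<Rightarrow> bit vec \<Rightarrow> z2r set \<Rightarrow> z2r set" where
  "double_extension \<alpha> x C = {(vCons (z \<bullet> x) (vCons b z), w) | b z w.
     z \<in> carrier_vec \<alpha> \<and> (z + (z \<bullet> x + b) \<cdot>\<^sub>v x, w) \<in> C}"

text \<open>The correction is written with \<open>a + b\<close> instead of
  \<open>z \<bullet> x + b\<close>, which is the form that orthogonality to the rows
  produces.\<close>

lemma double_extension_iff:
  "(vCons a (vCons b z), w) \<in> double_extension \<alpha> x C \<longleftrightarrow>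
     a = z \<bullet> x \<and> z \<in> carrier_vec \<alpha> \<and> (z + (a + b) \<cdot>\<^sub>v x, w) \<in> C"
  by (auto simp: double_extension_def)

text \<open>Both the condition on the first bit and the corrected vector depend linearly on the
  word.\<close>

lemma double_extension_linear_code:
  assumes C: "z2r_linear_code \<alpha> \<beta> C" and x: "x \<in> carrier_vec \<alpha>"
  shows "z2r_linear_code (\<alpha> + 2) \<beta> (double_extension \<alpha> x C)"
  unfolding z2r_linear_code_iff
proof (intro conjI allI impI)
  have sub: "C \<subseteq> carrier_vec \<alpha> \<times> carrier_vec \<beta>" and zero: "(0\<^sub>v \<alpha>, 0\<^sub>v \<beta>) \<in> C"
    and add: "\<And>a b a' b'. (a, b) \<in> C \<Longrightarrow> (a', b') \<in> C \<Longrightarrow> (a + a', b + b') \<in> C"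
    and smult: "\<And>k a b. (a, b) \<in> C \<Longrightarrow> (eta k \<cdot>\<^sub>v a, k \<cdot>\<^sub>v b) \<in> C"
    using C by (auto simp: z2r_linear_code_iff)
  show "double_extension \<alpha> x C \<subseteq> carrier_vec (\<alpha> + 2) \<times> carrier_vec \<beta>"
    using sub by (auto simp: double_extension_def)
  show "(0\<^sub>v (\<alpha> + 2), 0\<^sub>v \<beta>) \<in> double_extension \<alpha> x C"
    using zero x by (auto simp: double_extension_iff zero_vec_Suc)
  {
    fix v w v' w'
    assume "(v, w) \<in> double_extension \<alpha> x C" "(v', w') \<in> double_extension \<alpha> x C"
    then obtain b z b' z' where
      v: "v = vCons (z \<bullet> x) (vCons b z)" "z \<in> carrier_vec \<alpha>" "(z + (z \<bullet> x + b) \<cdot>\<^sub>v x, w) \<in> C"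
      and v': "v' = vCons (z' \<bullet> x) (vCons b' z')" "z' \<in> carrier_vec \<alpha>"
        "(z' + (z' \<bullet> x + b') \<cdot>\<^sub>v x, w') \<in> C"
      by (auto simp: double_extension_def)
    have "z + (z \<bullet> x + b) \<cdot>\<^sub>v x + (z' + (z' \<bullet> x + b') \<cdot>\<^sub>v x)
        = z + z' + (z \<bullet> x + z' \<bullet> x + (b + b')) \<cdot>\<^sub>v x"
      by (simp only: add_smult_add_vec[OF x v(2) v'(2)] ac_simps)
    with add[OF v(3) v'(3)] show "(v + v', w + w') \<in> double_extension \<alpha> x C"
      unfolding v(1) v'(1) vCons_add double_extension_iff
      using v(2) v'(2) x by (simp only: add_scalar_prod_distrib[of _ \<alpha>] add_carrier_vec simp_thms)
  }
  fix k v w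
  assume "(v, w) \<in> double_extension \<alpha> x C"
  then obtain b z where
    v: "v = vCons (z \<bullet> x) (vCons b z)" "z \<in> carrier_vec \<alpha>" "(z + (z \<bullet> x + b) \<cdot>\<^sub>v x, w) \<in> C"
    by (auto simp: double_extension_def)
  have "eta k \<cdot>\<^sub>v (z + (z \<bullet> x + b) \<cdot>\<^sub>v x)
      = eta k \<cdot>\<^sub>v z + (eta k * (z \<bullet> x) + eta k * b) \<cdot>\<^sub>v x"
    by (simp only: smult_add_smult_vec[OF x v(2)] distrib_left)
  with smult[OF v(3), of k] show "(eta k \<cdot>\<^sub>v v, k \<cdot>\<^sub>v w) \<in> double_extension \<alpha> x C"
    unfolding v(1) smult_vCons double_extension_iff
    using v(2) x by (simp only: smult_scalar_prod_distrib[of _ \<alpha>] smult_carrier_vec simp_thms)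
qed

lemma separable_double_extension_iff:
  assumes C: "z2r_linear_code \<alpha> \<beta> C" and x: "x \<in> carrier_vec \<alpha>"
  shows "separable (double_extension \<alpha> x C) \<longleftrightarrow> separable C"
  unfolding separable_linear_code_iff[OF C]
    separable_linear_code_iff[OF double_extension_linear_code[OF C x]]
proof (intro iffI allI impI)
  fix v w
  assume "\<forall>a b. (a, b) \<in> C \<longrightarrow> (a, 0\<^sub>v \<beta>) \<in> C" "(v, w) \<in> double_extension \<alpha> x C"
  then show "(v, 0\<^sub>v \<beta>) \<in> double_extension \<alpha> x C"
    unfolding double_extension_def by blast
next
  fix z w
  assume *: "\<forall>a b. (a, b) \<in> double_extension \<alpha> x C \<longrightarrow> (a, 0\<^sub>v \<beta>) \<in> double_extension \<alpha> x C"
    and zw: "(z, w) \<in> C"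
  have z: "z \<in> carrier_vec \<alpha>" using zw C by (auto simp: z2r_linear_code_iff)
  \<comment> \<open>With both leading bits equal to \<open>z \<bullet> x\<close> the correction is
    zero, so \<open>C\<close> embeds with its \<open>R\<close>-part unchanged.\<close>
  have iff: "(vCons (z \<bullet> x) (vCons (z \<bullet> x) z), w') \<in> double_extension \<alpha> x C \<longleftrightarrow> (z, w') \<in> C" for w'
    using z x by (simp add: double_extension_iff)
  show "(z, 0\<^sub>v \<beta>) \<in> C" by (rule iff[THEN iffD1]) (use * zw iff in blast)
qed

text \<open>Words with equal leading bits come from the span by a linear embedding; adding the first
  row reduces every other word to one of these.\<close>

lemma double_extension_span_subset:
  assumes S: "S \<subseteq> carrier_vec \<alpha> \<times> carrier_vec \<beta>"
    and x: "x \<in> carrier_vec \<alpha>" "x \<bullet> x = 1"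
    and y: "(0\<^sub>v \<alpha>, y) \<in> z2r_span \<alpha> \<beta> S"
    and D: "z2r_linear_code (\<alpha> + 2) \<beta> D"
    and row1: "(vCons 1 (vCons 0 x), y) \<in> D"
    and rows: "\<And>z w. (z, w) \<in> S \<Longrightarrow> (vCons (z \<bullet> x) (vCons (z \<bullet> x) z), w) \<in> D"
  shows "double_extension \<alpha> x (z2r_span \<alpha> \<beta> S) \<subseteq> D"
proof -
  \<comment> \<open>The preimage of \<open>D\<close> under the \<open>R\<close>-linear map sending
    \<open>(z | w)\<close> to \<open>(z \<bullet> x, z \<bullet> x, z | w)\<close>. It is a code
    containing \<open>S\<close>, hence contains the span.\<close>
  let ?N = "{(z, w). z \<in> carrier_vec \<alpha> \<and> w \<in> carrier_vec \<beta> \<and>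
    (vCons (z \<bullet> x) (vCons (z \<bullet> x) z), w) \<in> D}"
  have zero: "(0\<^sub>v (\<alpha> + 2), 0\<^sub>v \<beta>) \<in> D"
    and add: "\<And>a b a' b'. (a, b) \<in> D \<Longrightarrow> (a', b') \<in> D \<Longrightarrow> (a + a', b + b') \<in> D"
    and smult: "\<And>k a b. (a, b) \<in> D \<Longrightarrow> (eta k \<cdot>\<^sub>v a, k \<cdot>\<^sub>v b) \<in> D"
    using D by (auto simp: z2r_linear_code_iff)
  have "z2r_linear_code \<alpha> \<beta> ?N"
    unfolding z2r_linear_code_iff
  proof (intro conjI allI impI)
    show "(0\<^sub>v \<alpha>, 0\<^sub>v \<beta>) \<in> ?N" using zero x by (simp add: zero_vec_Suc)
  next
    fix a b a' b' assume "(a, b) \<in> ?N" "(a', b') \<in> ?N"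
    then show "(a + a', b + b') \<in> ?N"
      using add[of "vCons (a \<bullet> x) (vCons (a \<bullet> x) a)" b "vCons (a' \<bullet> x) (vCons (a' \<bullet> x) a')" b'] x
      by (auto simp: vCons_add add_scalar_prod_distrib[of _ \<alpha>])
  next
    fix k a b assume "(a, b) \<in> ?N"
    then show "(eta k \<cdot>\<^sub>v a, k \<cdot>\<^sub>v b) \<in> ?N"
      using smult[of "vCons (a \<bullet> x) (vCons (a \<bullet> x) a)" b k] x by (auto simp: smult_vCons)
  qed auto
  then have N: "z2r_span \<alpha> \<beta> S \<subseteq> ?N"
    using S rows by (intro z2r_span_least) auto
  have C_add: "\<And>a b a' b'. (a, b) \<in> z2r_span \<alpha> \<beta> S \<Longrightarrow> (a', b') \<in> z2r_span \<alpha> \<beta> S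
      \<Longrightarrow> (a + a', b + b') \<in> z2r_span \<alpha> \<beta> S"
    and C_sub: "z2r_span \<alpha> \<beta> S \<subseteq> carrier_vec \<alpha> \<times> carrier_vec \<beta>"
    using z2r_span_linear_code[OF S] by (auto simp: z2r_linear_code_iff)
  have yc: "y \<in> carrier_vec \<beta>" using y C_sub by auto
  show ?thesis
  proof
    fix v assume "v \<in> double_extension \<alpha> x (z2r_span \<alpha> \<beta> S)"
    then obtain b z w where v: "v = (vCons (z \<bullet> x) (vCons b z), w)" "z \<in> carrier_vec \<alpha>"
      and c: "(z + (z \<bullet> x + b) \<cdot>\<^sub>v x, w) \<in> z2r_span \<alpha> \<beta> S"
      by (auto simp: double_extension_def)
    have wc: "w \<in> carrier_vec \<beta>" using c C_sub by auto
    show "v \<in> D"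
    proof (cases "z \<bullet> x = b")
      case True
      then have "(z, w) \<in> z2r_span \<alpha> \<beta> S" using c v(2) x(1) by simp
      then show ?thesis using N True v(1) by auto
    next
      case False
      then have s: "z \<bullet> x + b = 1" by (cases b; cases "z \<bullet> x") simp_all
      then have s': "b + 1 = z \<bullet> x" by (cases b; cases "z \<bullet> x") simp_all
      \<comment> \<open>Adding \<open>(0 | y)\<close> prepares the \<open>R\<close>-part, so that
        the \<open>y\<close> of the first row cancels below.\<close>
      have "(z + x + 0\<^sub>v \<alpha>, w + y) \<in> z2r_span \<alpha> \<beta> S"
        using C_add[OF c y] unfolding s one_smult_vec .
      then have "(z + x, w + y) \<in> ?N" using N v(2) x(1) by auto
      \<comment> \<open>Here \<open>x \<bullet> x = 1\<close> enters: adding \<open>x\<close> flips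
        the product from \<open>z \<bullet> x\<close> to \<open>b\<close>, so the embedded word has
        both leading bits \<open>b\<close>.\<close>
      moreover have "(z + x) \<bullet> x = b"
        using x v(2) by (simp only: add_scalar_prod_distrib[of _ \<alpha>] s'[symmetric] add.assoc bit_add_self add_0_right)
      ultimately have "(vCons b (vCons b (z + x)), w + y) \<in> D" by simp
      \<comment> \<open>The first row flips only the first leading bit, giving
        \<open>b + 1 = z \<bullet> x\<close>, and removes \<open>x\<close> and \<open>y\<close>
        again.\<close>
      from add[OF this row1]
      have "(vCons (b + 1) (vCons (b + 0) (z + x + x)), w + y + y) \<in> D"
        by (simp only: vCons_add)
      moreover have "z + x + x = z"
        using v(2) x(1) by (simp add: assoc_add_vec[of _ \<alpha>] vec_bit_add_self)
      moreover have "w + y + y = w"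
        using wc yc by (simp add: assoc_add_vec[of _ \<beta>] vec_z2u_add_self)
      ultimately show ?thesis by (simp only: v(1) s' add_0_right)
    qed
  qed
qed

section \<open>Self-duality and separability of the code generated by \<open>G\<close>\<close>

theorem theorem3p5:
  fixes \<alpha> \<beta> \<gamma> \<delta> \<kappa> :: nat
    and C D :: "z2r set"
    and g :: "nat \<Rightarrow> bit vec" and r :: "nat \<Rightarrow> z2u vec"
    and x :: "bit vec" and y :: "z2u vec"
    and h :: "nat \<Rightarrow> bit" and G :: "z2r list"
  assumes "z2r_linear_code \<alpha> \<beta> C"
    and "self_dual \<alpha> \<beta> C"
    and "z2r_type \<alpha> \<beta> \<gamma> \<delta> \<kappa> C"
    and "\<And>i. i \<in> {1..\<gamma> + \<delta>} \<Longrightarrow> g i \<in> carrier_vec \<alpha>"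
    and "\<And>i. i \<in> {1..\<gamma> + \<delta>} \<Longrightarrow> r i \<in> carrier_vec \<beta>"
    and "generator_matrix \<alpha> \<beta> (map (\<lambda>i. (g i, r i)) [1..<\<gamma> + \<delta> + 1]) C"
    and "x \<in> carrier_vec \<alpha>" and "odd (hamming_weight x)"
    and "y \<in> carrier_vec \<beta>" and "\<And>j. j < \<beta> \<Longrightarrow> y $ j \<in> {0, u_elt}"
    and "\<And>i. i \<in> {1..\<gamma> + \<delta>} \<Longrightarrow> r i \<bullet> y = 0"
  defines "h \<equiv> \<lambda>i. g i \<bullet> x"
    and "G \<equiv> (vCons 1 (vCons 0 x), y) #
               map (\<lambda>i. (vCons (h i) (vCons (h i) (g i)), r i)) [1..<\<gamma> + \<delta> + 1]"
    and "D \<equiv> z2r_span (\<alpha> + 2) \<beta> (set G)"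
  shows "generator_matrix (\<alpha> + 2) \<beta> G D \<and>
         z2r_linear_code (\<alpha> + 2) \<beta> D \<and>
         self_dual (\<alpha> + 2) \<beta> D \<and>
         (separable C \<longleftrightarrow> separable D)"
proof -
  let ?I = "{1..\<gamma> + \<delta>}"
  let ?row = "\<lambda>i. (vCons (h i) (vCons (h i) (g i)), r i)"
  define S where "S = (\<lambda>i. (g i, r i)) ` ?I"
  note g = assms(4) and r = assms(5) and x = \<open>x \<in> carrier_vec \<alpha>\<close> and y = \<open>y \<in> carrier_vec \<beta>\<close>
  have I: "set [1..<\<gamma> + \<delta> + 1] = ?I" by auto
  have S: "S \<subseteq> carrier_vec \<alpha> \<times> carrier_vec \<beta>" using g r by (auto simp: S_def)
  have C: "C = z2r_span \<alpha> \<beta> S"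
    using assms(6) by (simp only: generator_matrix_def set_map I S_def)
  \<comment> \<open>By self-duality, membership in \<open>C\<close> can be tested by orthogonality
    to the rows alone.\<close>
  have dual: "z2r_dual \<alpha> \<beta> S = C"
    using assms(2) z2r_dual_span[OF S] by (simp add: self_dual_def C)
  have G: "set G = insert (vCons 1 (vCons 0 x), y) (?row ` ?I)"
    by (simp only: G_def list.set set_map I)
  have G_carrier: "set G \<subseteq> carrier_vec (\<alpha> + 2) \<times> carrier_vec \<beta>"
    using g r x y by (auto simp: G)
  have D: "z2r_linear_code (\<alpha> + 2) \<beta> D"
    unfolding D_def by (rule z2r_span_linear_code[OF G_carrier])
  have xx: "x \<bullet> x = 1"
    using \<open>odd (hamming_weight x)\<close> by (simp add: scalar_prod_self_bit)
  \<comment> \<open>The assumption on the \<open>r i\<close> makes \<open>(0 | y)\<close> orthogonal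
    to all rows of \<open>C\<close>.\<close>
  have yC: "(0\<^sub>v \<alpha>, y) \<in> C"
    unfolding dual[symmetric] using assms(11) g r y comm_scalar_prod[OF y r]
    by (auto simp: S_def z2r_dual_def z2r_inner_def of_z2_simps)
  have wy: "w \<bullet> y = 0" if "(z, w) \<in> C" for z w
  proof -
    have "(z, w) \<in> z2r_dual \<alpha> \<beta> C" using that assms(2) by (simp add: self_dual_def)
    then show ?thesis using yC by (force simp: z2r_dual_def z2r_inner_def of_z2_simps)
  qed
  have dual_D: "z2r_dual (\<alpha> + 2) \<beta> D = double_extension \<alpha> x C"
  proof -
    have "v \<in> z2r_dual (\<alpha> + 2) \<beta> (set G) \<longleftrightarrow> v \<in> double_extension \<alpha> x C"
      if v: "v = (vCons a (vCons b z), w)" "z \<in> carrier_vec \<alpha>" "w \<in> carrier_vec \<beta>" for v a b z w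
    proof -
      \<comment> \<open>The leading bits contribute \<open>(a + b) * h i\<close>, and
        \<open>h i = g i \<bullet> x\<close>. This contribution can be moved into the vector as the
        correction \<open>(a + b) \<cdot>\<^sub>v x\<close>.\<close>
      have "z2r_inner v (?row i) = z2r_inner (z + (a + b) \<cdot>\<^sub>v x, w) (g i, r i)" if "i \<in> ?I" for i
      proof -
        have "(z + (a + b) \<cdot>\<^sub>v x) \<bullet> g i = z \<bullet> g i + (a + b) * (g i \<bullet> x)"
          using v x g[OF that] comm_scalar_prod[OF x g[OF that]]
          by (simp only: add_scalar_prod_distrib[of _ \<alpha>] smult_carrier_vec smult_scalar_prod_distrib[of _ \<alpha>])
        then show ?thesis
          by (simp only: v(1) z2r_inner_def h_def fst_conv snd_conv scalar_prod_vCons distrib_right ac_simps)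
      qed
      then have rows: "(\<forall>i\<in>?I. z2r_inner v (?row i) = 0) \<longleftrightarrow> (z + (a + b) \<cdot>\<^sub>v x, w) \<in> C"
        using v x unfolding dual[symmetric] by (simp add: z2r_dual_def S_def)
      have "z2r_inner v (vCons 1 (vCons 0 x), y) = u_elt * of_z2 (a + z \<bullet> x) + w \<bullet> y"
        using v by (simp add: z2r_inner_def)
      \<comment> \<open>The equivalence is conditional: only for \<open>w\<close> occurring in a
        codeword of \<open>C\<close> does \<open>w \<bullet> y\<close> vanish, leaving a multiple of
        \<open>u_elt\<close>.\<close>
      then have row1: "z2r_inner v (vCons 1 (vCons 0 x), y) = 0 \<longleftrightarrow> a + z \<bullet> x = 0"
        if "(z + (a + b) \<cdot>\<^sub>v x, w) \<in> C"
        by (simp only: wy[OF that] add_0_right u_elt_of_z2_eq_0_iff)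
      have "v \<in> z2r_dual (\<alpha> + 2) \<beta> (set G) \<longleftrightarrow>
          z2r_inner v (vCons 1 (vCons 0 x), y) = 0 \<and> (\<forall>i\<in>?I. z2r_inner v (?row i) = 0)"
        unfolding z2r_dual_def G using v by simp
      also have "\<dots> \<longleftrightarrow> a + z \<bullet> x = 0 \<and> (z + (a + b) \<cdot>\<^sub>v x, w) \<in> C"
        unfolding rows using row1 by blast
      also have "a + z \<bullet> x = 0 \<longleftrightarrow> a = z \<bullet> x" by (cases a; cases "z \<bullet> x") auto
      finally show ?thesis
        by (simp only: v double_extension_iff simp_thms)
    qed
    \<comment> \<open>Splitting the binary part twice with \<open>carrier_vec_Suc_cases\<close>
      exposes the two new leading bits.\<close>
    then have eq: "v \<in> z2r_dual (\<alpha> + 2) \<beta> (set G) \<longleftrightarrow> v \<in> double_extension \<alpha> x C"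
      if "v \<in> carrier_vec (\<alpha> + 2) \<times> carrier_vec \<beta>" for v
      using that by (auto elim!: carrier_vec_Suc_cases)
    have sub: "z2r_dual (\<alpha> + 2) \<beta> (set G) \<subseteq> carrier_vec (\<alpha> + 2) \<times> carrier_vec \<beta>"
      by (auto simp: z2r_dual_def)
    have sub': "double_extension \<alpha> x C \<subseteq> carrier_vec (\<alpha> + 2) \<times> carrier_vec \<beta>"
      using double_extension_linear_code[OF assms(1) x] by (simp add: z2r_linear_code_iff)
    show ?thesis
      unfolding D_def z2r_dual_span[OF G_carrier]
    proof (intro subset_antisym subsetI)
      fix v assume "v \<in> z2r_dual (\<alpha> + 2) \<beta> (set G)"
      then show "v \<in> double_extension \<alpha> x C" using eq[OF subsetD[OF sub]] by simp
    next
      fix v assume "v \<in> double_extension \<alpha> x C"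
      then show "v \<in> z2r_dual (\<alpha> + 2) \<beta> (set G)" using eq[OF subsetD[OF sub']] by simp
    qed
  qed
  have "D = double_extension \<alpha> x C"
  proof
    show "D \<subseteq> double_extension \<alpha> x C"
      unfolding D_def
    proof (rule z2r_span_least[OF _ double_extension_linear_code[OF assms(1) x]])
      have "S \<subseteq> C" unfolding C by (rule z2r_span_superset[OF S])
      \<comment> \<open>For the first row, \<open>x \<bullet> x = 1\<close> gives the leading bit
        and the correction \<open>x + x = 0\<close> leaves \<open>(0 | y)\<close>, a word of
        \<open>C\<close>. The other rows have equal leading bits and reduce to
        \<open>(g i | r i)\<close>.\<close>
      then show "set G \<subseteq> double_extension \<alpha> x C"
        using yC xx x g by (auto simp: G S_def double_extension_iff h_def vec_bit_add_self one_smult_vec)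
    qed
    show "double_extension \<alpha> x C \<subseteq> D"
      unfolding C
    proof (rule double_extension_span_subset[OF S x xx _ D])
      show "(0\<^sub>v \<alpha>, y) \<in> z2r_span \<alpha> \<beta> S" using yC by (simp add: C)
      have GD: "set G \<subseteq> D" unfolding D_def by (rule z2r_span_superset[OF G_carrier])
      then show "(vCons 1 (vCons 0 x), y) \<in> D" by (simp add: G)
      show "(vCons (z \<bullet> x) (vCons (z \<bullet> x) z), w) \<in> D" if "(z, w) \<in> S" for z w
        using that GD by (auto simp: G S_def h_def)
    qed
  qed
  \<comment> \<open>Both \<open>D\<close> and its dual are now the same extension of
    \<open>C\<close>, which is self-duality; separability transfers along the same equation.\<close>
  then show ?thesis
    using D G_carrier dual_D separable_double_extension_iff[OF assms(1) x]
    by (simp add: generator_matrix_def self_dual_def D_def)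
qed

end
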